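(* Suppose $(\pi,N)$ is a Leibniz $r-n$ structure on a Leibniz algebra $(\mathfrak g,[\ ,\ ])$. Then $(\pi^\sharp,N^*,N)$ is a dual $\mathcal O$N-structure on $(\mathfrak g,[\ ,\ ])$ associated to the dual regular representation $(\mathfrak g^*,L^*,-L^*-R^* )$.
   Context: $k$ is a field of characteristic $0$; all vector spaces are finite dimensional over $k$. A (left) Leibniz algebra $(\mathfrak g,[\ ,\ ])$ is a vector space with a bilinear bracket satisfying $[x,[y,z]]=[[x,y],z]+[y,[x,z]]$. A representation $(V,\rho^L,\rho^R)$ of it is a vector space $V$ with linear maps $\rho^L,\rho^R:\mathfrak g\to\mathfrak{gl}(V)$ such that for all $x,y\in\mathfrak g$: $\rho^L([x,y])=[\rho^L(x),\rho^L(y)]$, $\rho^R([x,y])=[\rho^L(x),\rho^R(y)]$ (commutators), and $\rho^R(y)\rho^L(x)=-\rho^R(y)\rho^R(x)$. With $L(x)y=[x,y]=R(y)x$ and $\langle L^*(x)\alpha,y\rangle=-\langle\alpha,L(x)y\rangle$, $\langle R^*(x)\alpha,y\rangle=-\langle\alpha,R(x)y\rangle$, the triple $(\mathfrak g^*,L^*,-L^*-R^* )$ is a representation of $\mathfrak g$ (the dual regular representation). $N^*$ is the usual transpose of $N$. For $\pi\in\mathrm{Sym}^2(\mathfrak g)$ let $\pi^\sharp:\mathfrak g^*\to\mathfrak g$, $\langle\pi^\sharp(\alpha),\beta\rangle=\pi(\alpha,\beta)$. Classical Leibniz $r$-matrix: on $E=\mathfrak g\oplus\mathfrak g^*$ let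 $\mu_\ltimes(x+\alpha,y+\beta)=[x,y]+L^*(x)\beta-(L^*+R^* )(y)\alpha$; let $\widehat{\pi^\sharp}(x+\alpha)=\pi^\sharp(\alpha)$; for bilinear $\mu$ and linear $T$ on $E$ put $\{\mu,T\}^B(u,v)=\mu(T(u),v)+\mu(u,T(v))-T(\mu(u,v))$; let $\{\{\pi^\sharp,\pi^\sharp\}\}=-\{\{\mu_\ltimes,\widehat{\pi^\sharp}\}^B,\widehat{\pi^\sharp}\}^B$ restricted to $\mathfrak g^*\times\mathfrak g^*$ (it takes values in $\mathfrak g$); and define $[[\pi,\pi]]\in\otimes^3\mathfrak g$ by $\langle[[\pi,\pi]],\xi_1\otimes\xi_2\otimes\xi_3\rangle=\langle\{\{\pi^\sharp,\pi^\sharp\}\}(\xi_1,\xi_2),\xi_3\rangle$. Then $\pi\in\mathrm{Sym}^2(\mathfrak g)$ is a classical Leibniz $r$-matrix if $[[\pi,\pi]]=0$ (classical Leibniz Yang-Baxter equation). A Nijenhuis operator on $\mathfrak g$ is a linear endomorphism $N$ with $[N(x),N(y)]=N([N(x),y]+[x,N(y)]-N[x,y])$. Leibniz $r-n$ structure: a pair $(\pi,N)$ with $\pi$ a classical Leibniz $r$-matrix and $N$ a Nijenhuis operator on $\mathfrak g$ such that $N\pi^\sharp=\pi^\sharp N^*$ and, for all $\alpha,\beta\in\mathfrak g^*$, $[\alpha,\beta]^{N\pi^\sharp}=[\alpha,\beta]_{N^*}^{\pi^\sharp}$, where $[\alpha,\beta]^{T}=L^*(T(\alpha))\beta-(L^*+R^*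 )(T(\beta))\alpha$ for linear $T:\mathfrak g^*\to\mathfrak g$, and $[\alpha,\beta]_{N^*}^{\pi^\sharp}=[N^*(\alpha),\beta]^{\pi^\sharp}+[\alpha,N^*(\beta)]^{\pi^\sharp}-N^*[\alpha,\beta]^{\pi^\sharp}$. Dual $\mathcal O$N-structure on $\mathfrak g$ associated to a representation $(V,\rho^L,\rho^R)$: a triple $(K,S,N)$ with $K:V\to\mathfrak g$ linear, $S\in\mathfrak{gl}(V)$, $N\in\mathfrak{gl}(\mathfrak g)$ such that: $K$ is an $\mathcal O$-operator, i.e. $[K(u),K(v)]=K([u,v]^K)$ with $[u,v]^K=\rho^L(K(u))v+\rho^R(K(v))u$; $N$ is a Nijenhuis operator and for all $y\in\mathfrak g$, $w\in V$ and each $\rho\in\{\rho^L,\rho^R\}$, $\rho(N(y))S(w)=S(\rho(N(y))w)+\rho(y)S^2(w)-S(\rho(y)S(w))$; $NK=KS$; and $\rho^L(NK(w))u+\rho^R(NK(u))w=[S(w),u]^K+[w,S(u)]^K-S[w,u]^K$ for all $w,u\in V$. *)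

theory Defs
  imports Complex_Main "HOL-Library.Function_Algebras" "HOL-Library.Product_Plus"
begin

text \<open>
  A vector space over the field \<open>'k\<close> is given by its scalar multiplication. The algebra
  \<open>\<gg>\<close> is the whole type \<open>'g\<close>; the dual space depends on the scalar multiplication of \<open>\<gg>\<close>, so it is
  not a type but the subspace of linear functionals in \<open>'g \<Rightarrow> 'k\<close>. Representations therefore live on
  subspaces of an ambient vector space.
\<close>

locale leibniz_algebra =
  vector_space scale for scale :: "'k::field_char_0 \<Rightarrow> 'g::ab_group_add \<Rightarrow> 'g" +
  fixes br :: "'g \<Rightarrow> 'g \<Rightarrow> 'g"
  assumes finite_dim: "\<exists>B. finite_dimensional_vector_space scale B"
    and linear_right: "\<And>x. Vector_Spaces.linear scale scale (\<lambda>y. br x y)"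
    and linear_left: "\<And>y. Vector_Spaces.linear scale scale (\<lambda>x. br x y)"
    and leibniz: "\<And>x y z. br x (br y z) = br (br x y) z + br y (br x z)"

definition linear_on ::
  "('k \<Rightarrow> 'a \<Rightarrow> 'a) \<Rightarrow> ('k \<Rightarrow> 'b \<Rightarrow> 'b) \<Rightarrow> 'a set \<Rightarrow> 'b set
    \<Rightarrow> ('a::ab_group_add \<Rightarrow> 'b::ab_group_add) \<Rightarrow> bool" where
  "linear_on s1 s2 A B f \<longleftrightarrow>
     (\<forall>x\<in>A. f x \<in> B) \<and>
     (\<forall>x\<in>A. \<forall>y\<in>A. f (x + y) = f x + f y) \<and>
     (\<forall>c. \<forall>x\<in>A. f (s1 c x) = s2 c (f x))"

definition bilinear_on ::
  "('k \<Rightarrow> 'a \<Rightarrow> 'a) \<Rightarrow> ('k \<Rightarrow> 'b \<Rightarrow> 'b) \<Rightarrow> ('k \<Rightarrow> 'c \<Rightarrow> 'c) \<Rightarrow> 'a set \<Rightarrow> 'b set \<Rightarrow> 'c set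
    \<Rightarrow> ('a::ab_group_add \<Rightarrow> 'b::ab_group_add \<Rightarrow> 'c::ab_group_add) \<Rightarrow> bool" where
  "bilinear_on s1 s2 s3 A B C f \<longleftrightarrow>
     (\<forall>x\<in>A. linear_on s2 s3 B C (\<lambda>y. f x y)) \<and>
     (\<forall>y\<in>B. linear_on s1 s3 A C (\<lambda>x. f x y))"

text \<open>Linearity of \<open>\<rho>L, \<rho>R : \<gg> \<rightarrow> \<gg>\<ll>(V)\<close> is expressed as bilinearity of the action
  \<open>\<gg> \<times> V \<rightarrow> V\<close>.\<close>

definition leibniz_rep ::
  "('k::field_char_0 \<Rightarrow> 'g::ab_group_add \<Rightarrow> 'g) \<Rightarrow> ('g \<Rightarrow> 'g \<Rightarrow> 'g)
    \<Rightarrow> ('k \<Rightarrow> 'v::ab_group_add \<Rightarrow> 'v) \<Rightarrow> 'v set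
    \<Rightarrow> ('g \<Rightarrow> 'v \<Rightarrow> 'v) \<Rightarrow> ('g \<Rightarrow> 'v \<Rightarrow> 'v) \<Rightarrow> bool" where
  "leibniz_rep scale br sV V \<rho>L \<rho>R \<longleftrightarrow>
     vector_space sV \<and> module.subspace sV V \<and>
     (\<exists>B. finite B \<and> module.span sV B = V) \<and>
     bilinear_on scale sV sV UNIV V V \<rho>L \<and>
     bilinear_on scale sV sV UNIV V V \<rho>R \<and>
     (\<forall>x y. \<forall>v\<in>V. \<rho>L (br x y) v = \<rho>L x (\<rho>L y v) - \<rho>L y (\<rho>L x v)) \<and>
     (\<forall>x y. \<forall>v\<in>V. \<rho>R (br x y) v = \<rho>L x (\<rho>R y v) - \<rho>R y (\<rho>L x v)) \<and>
     (\<forall>x y. \<forall>v\<in>V. \<rho>R y (\<rho>L x v) = - \<rho>R y (\<rho>R x v))"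


definition dual :: "('k::field_char_0 \<Rightarrow> 'g::ab_group_add \<Rightarrow> 'g) \<Rightarrow> ('g \<Rightarrow> 'k) set" where
  "dual scale = {\<alpha>. Vector_Spaces.linear scale (*) \<alpha>}"

definition dual_scale :: "'k::field_char_0 \<Rightarrow> ('g \<Rightarrow> 'k) \<Rightarrow> 'g \<Rightarrow> 'k" where
  "dual_scale c \<alpha> = (\<lambda>x. c * \<alpha> x)"

definition transpose_map :: "('g \<Rightarrow> 'g) \<Rightarrow> ('g \<Rightarrow> 'k) \<Rightarrow> 'g \<Rightarrow> 'k" where
  "transpose_map N \<alpha> = (\<lambda>x. \<alpha> (N x))"

definition Lstar :: "('g \<Rightarrow> 'g \<Rightarrow> 'g) \<Rightarrow> 'g \<Rightarrow> ('g \<Rightarrow> 'k::field_char_0) \<Rightarrow> 'g \<Rightarrow> 'k" where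
  "Lstar br x \<alpha> = (\<lambda>y. - \<alpha> (br x y))"

definition Rstar :: "('g \<Rightarrow> 'g \<Rightarrow> 'g) \<Rightarrow> 'g \<Rightarrow> ('g \<Rightarrow> 'k::field_char_0) \<Rightarrow> 'g \<Rightarrow> 'k" where
  "Rstar br x \<alpha> = (\<lambda>y. - \<alpha> (br y x))"


text \<open>By finite-dimensionality, elements of \<open>\<gg> \<otimes> \<gg>\<close> and \<open>\<otimes>\<^sup>3 \<gg>\<close> are identified with bilinear and
  trilinear forms on the dual space; the values of these forms outside \<^const>\<open>dual\<close> are irrelevant.\<close>

definition Sym2 ::
  "('k::field_char_0 \<Rightarrow> 'g::ab_group_add \<Rightarrow> 'g) \<Rightarrow> (('g \<Rightarrow> 'k) \<Rightarrow> ('g \<Rightarrow> 'k) \<Rightarrow> 'k) set" where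
  "Sym2 scale = {\<pi>. bilinear_on dual_scale dual_scale (*) (dual scale) (dual scale) UNIV \<pi> \<and>
                    (\<forall>\<alpha>\<in>dual scale. \<forall>\<beta>\<in>dual scale. \<pi> \<alpha> \<beta> = \<pi> \<beta> \<alpha>)}"

definition sharp ::
  "('k::field_char_0 \<Rightarrow> 'g::ab_group_add \<Rightarrow> 'g) \<Rightarrow> (('g \<Rightarrow> 'k) \<Rightarrow> ('g \<Rightarrow> 'k) \<Rightarrow> 'k)
    \<Rightarrow> ('g \<Rightarrow> 'k) \<Rightarrow> 'g" where
  "sharp scale \<pi> \<alpha> = (THE x. \<forall>\<beta>\<in>dual scale. \<beta> x = \<pi> \<alpha> \<beta>)"

definition mu_ltimes ::
  "('g::ab_group_add \<Rightarrow> 'g \<Rightarrow> 'g)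
    \<Rightarrow> 'g \<times> ('g \<Rightarrow> 'k::field_char_0) \<Rightarrow> 'g \<times> ('g \<Rightarrow> 'k) \<Rightarrow> 'g \<times> ('g \<Rightarrow> 'k)" where
  "mu_ltimes br = (\<lambda>(x, \<alpha>) (y, \<beta>).
     (br x y, Lstar br x \<beta> - (Lstar br y \<alpha> + Rstar br y \<alpha>)))"

definition hat ::
  "(('g::ab_group_add \<Rightarrow> 'k::field_char_0) \<Rightarrow> 'g) \<Rightarrow> 'g \<times> ('g \<Rightarrow> 'k) \<Rightarrow> 'g \<times> ('g \<Rightarrow> 'k)" where
  "hat T = (\<lambda>(x, \<alpha>). (T \<alpha>, 0))"

definition balavoine :: "('e::ab_group_add \<Rightarrow> 'e \<Rightarrow> 'e) \<Rightarrow> ('e \<Rightarrow> 'e) \<Rightarrow> 'e \<Rightarrow> 'e \<Rightarrow> 'e" where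
  "balavoine \<mu> T = (\<lambda>u v. \<mu> (T u) v + \<mu> u (T v) - T (\<mu> u v))"

text \<open>On \<open>\<gg>\<^sup>* \<times> \<gg>\<^sup>*\<close> the double bracket takes values in \<open>\<gg> \<oplus> 0\<close>, whence \<^const>\<open>fst\<close>.\<close>

definition double_bracket ::
  "('g::ab_group_add \<Rightarrow> 'g \<Rightarrow> 'g) \<Rightarrow> (('g \<Rightarrow> 'k::field_char_0) \<Rightarrow> 'g)
    \<Rightarrow> ('g \<Rightarrow> 'k) \<Rightarrow> ('g \<Rightarrow> 'k) \<Rightarrow> 'g" where
  "double_bracket br T \<alpha> \<beta> =
     fst (- balavoine (balavoine (mu_ltimes br) (hat T)) (hat T) (0, \<alpha>) (0, \<beta>))"

definition square_bracket ::
  "('k::field_char_0 \<Rightarrow> 'g::ab_group_add \<Rightarrow> 'g) \<Rightarrow> ('g \<Rightarrow> 'g \<Rightarrow> 'g)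
    \<Rightarrow> (('g \<Rightarrow> 'k) \<Rightarrow> ('g \<Rightarrow> 'k) \<Rightarrow> 'k) \<Rightarrow> ('g \<Rightarrow> 'k) \<Rightarrow> ('g \<Rightarrow> 'k) \<Rightarrow> ('g \<Rightarrow> 'k) \<Rightarrow> 'k" where
  "square_bracket scale br \<pi> \<xi>1 \<xi>2 \<xi>3 = \<xi>3 (double_bracket br (sharp scale \<pi>) \<xi>1 \<xi>2)"

definition classical_leibniz_r_matrix ::
  "('k::field_char_0 \<Rightarrow> 'g::ab_group_add \<Rightarrow> 'g) \<Rightarrow> ('g \<Rightarrow> 'g \<Rightarrow> 'g)
    \<Rightarrow> (('g \<Rightarrow> 'k) \<Rightarrow> ('g \<Rightarrow> 'k) \<Rightarrow> 'k) \<Rightarrow> bool" where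
  "classical_leibniz_r_matrix scale br \<pi> \<longleftrightarrow>
     \<pi> \<in> Sym2 scale \<and>
     (\<forall>\<xi>1\<in>dual scale. \<forall>\<xi>2\<in>dual scale. \<forall>\<xi>3\<in>dual scale. square_bracket scale br \<pi> \<xi>1 \<xi>2 \<xi>3 = 0)"


definition nijenhuis ::
  "('k::field_char_0 \<Rightarrow> 'g::ab_group_add \<Rightarrow> 'g) \<Rightarrow> ('g \<Rightarrow> 'g \<Rightarrow> 'g) \<Rightarrow> ('g \<Rightarrow> 'g) \<Rightarrow> bool" where
  "nijenhuis scale br N \<longleftrightarrow>
     Vector_Spaces.linear scale scale N \<and>
     (\<forall>x y. br (N x) (N y) = N (br (N x) y + br x (N y) - N (br x y)))"

definition dual_bracket ::
  "('g::ab_group_add \<Rightarrow> 'g \<Rightarrow> 'g) \<Rightarrow> (('g \<Rightarrow> 'k::field_char_0) \<Rightarrow> 'g)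
    \<Rightarrow> ('g \<Rightarrow> 'k) \<Rightarrow> ('g \<Rightarrow> 'k) \<Rightarrow> 'g \<Rightarrow> 'k" where
  "dual_bracket br T \<alpha> \<beta> = Lstar br (T \<alpha>) \<beta> - (Lstar br (T \<beta>) \<alpha> + Rstar br (T \<beta>) \<alpha>)"

definition deformed_bracket :: "('v::ab_group_add \<Rightarrow> 'v \<Rightarrow> 'v) \<Rightarrow> ('v \<Rightarrow> 'v) \<Rightarrow> 'v \<Rightarrow> 'v \<Rightarrow> 'v" where
  "deformed_bracket b S u v = b (S u) v + b u (S v) - S (b u v)"

definition leibniz_rn_structure ::
  "('k::field_char_0 \<Rightarrow> 'g::ab_group_add \<Rightarrow> 'g) \<Rightarrow> ('g \<Rightarrow> 'g \<Rightarrow> 'g)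
    \<Rightarrow> (('g \<Rightarrow> 'k) \<Rightarrow> ('g \<Rightarrow> 'k) \<Rightarrow> 'k) \<Rightarrow> ('g \<Rightarrow> 'g) \<Rightarrow> bool" where
  "leibniz_rn_structure scale br \<pi> N \<longleftrightarrow>
     classical_leibniz_r_matrix scale br \<pi> \<and>
     nijenhuis scale br N \<and>
     (\<forall>\<alpha>\<in>dual scale. N (sharp scale \<pi> \<alpha>) = sharp scale \<pi> (transpose_map N \<alpha>)) \<and>
     (\<forall>\<alpha>\<in>dual scale. \<forall>\<beta>\<in>dual scale.
        dual_bracket br (N \<circ> sharp scale \<pi>) \<alpha> \<beta> =
        deformed_bracket (dual_bracket br (sharp scale \<pi>)) (transpose_map N) \<alpha> \<beta>)"


definition rep_bracket ::
  "('g \<Rightarrow> 'v \<Rightarrow> 'v::ab_group_add) \<Rightarrow> ('g \<Rightarrow> 'v \<Rightarrow> 'v) \<Rightarrow> ('v \<Rightarrow> 'g) \<Rightarrow> 'v \<Rightarrow> 'v \<Rightarrow> 'v" where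
  "rep_bracket \<rho>L \<rho>R K u v = \<rho>L (K u) v + \<rho>R (K v) u"

definition O_operator ::
  "('k::field_char_0 \<Rightarrow> 'g::ab_group_add \<Rightarrow> 'g) \<Rightarrow> ('g \<Rightarrow> 'g \<Rightarrow> 'g)
    \<Rightarrow> ('k \<Rightarrow> 'v::ab_group_add \<Rightarrow> 'v) \<Rightarrow> 'v set
    \<Rightarrow> ('g \<Rightarrow> 'v \<Rightarrow> 'v) \<Rightarrow> ('g \<Rightarrow> 'v \<Rightarrow> 'v) \<Rightarrow> ('v \<Rightarrow> 'g) \<Rightarrow> bool" where
  "O_operator scale br sV V \<rho>L \<rho>R K \<longleftrightarrow>
     linear_on sV scale V UNIV K \<and>
     (\<forall>u\<in>V. \<forall>v\<in>V. br (K u) (K v) = K (rep_bracket \<rho>L \<rho>R K u v))"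

definition dual_ON_structure ::
  "('k::field_char_0 \<Rightarrow> 'g::ab_group_add \<Rightarrow> 'g) \<Rightarrow> ('g \<Rightarrow> 'g \<Rightarrow> 'g)
    \<Rightarrow> ('k \<Rightarrow> 'v::ab_group_add \<Rightarrow> 'v) \<Rightarrow> 'v set
    \<Rightarrow> ('g \<Rightarrow> 'v \<Rightarrow> 'v) \<Rightarrow> ('g \<Rightarrow> 'v \<Rightarrow> 'v)
    \<Rightarrow> ('v \<Rightarrow> 'g) \<Rightarrow> ('v \<Rightarrow> 'v) \<Rightarrow> ('g \<Rightarrow> 'g) \<Rightarrow> bool" where
  "dual_ON_structure scale br sV V \<rho>L \<rho>R K S N \<longleftrightarrow>
     leibniz_rep scale br sV V \<rho>L \<rho>R \<and>
     O_operator scale br sV V \<rho>L \<rho>R K \<and>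
     linear_on sV sV V V S \<and>
     nijenhuis scale br N \<and>
     (\<forall>\<rho>\<in>{\<rho>L, \<rho>R}. \<forall>y. \<forall>w\<in>V.
        \<rho> (N y) (S w) = S (\<rho> (N y) w) + \<rho> y (S (S w)) - S (\<rho> y (S w))) \<and>
     (\<forall>w\<in>V. N (K w) = K (S w)) \<and>
     (\<forall>w\<in>V. \<forall>u\<in>V.
        \<rho>L (N (K w)) u + \<rho>R (N (K u)) w =
        deformed_bracket (rep_bracket \<rho>L \<rho>R K) S w u)"

end

theory Submission
  imports Defs
begin

text \<open>
  Two observations carry the proof, besides the standard fact that the dual regular representation
  is a representation.

  Expanding the double bracket of \<open>K = \<pi>\<^sup>\<sharp>\<close> on two covectors, every term in which the extension of
  \<open>K\<close> is applied twice in succession dies, because that extension squares to zero. What is left is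
  \<open>2 (K [\<alpha>, \<beta>]\<^sup>K - [K \<alpha>, K \<beta>])\<close> (\<open>double_bracket_eq\<close>). In characteristic zero, the classical Leibniz
  Yang-Baxter equation therefore says exactly that \<open>K\<close> is an \<open>\<O>\<close>-operator for the dual regular
  representation (\<open>r_matrix_O_operator\<close>).

  The condition relating \<open>N\<close>, \<open>N\<^sup>*\<close> and an action is the Nijenhuis identity in disguise. Paired with a
  vector \<open>z\<close>, the condition for \<open>L\<^sup>*\<close> at \<open>y\<close> and \<open>w\<close> becomes \<open>w\<close> applied to the identity for
  \<open>[N y, N z]\<close>, and the one for \<open>R\<^sup>*\<close> becomes \<open>w\<close> applied to the identity for \<open>[N z, N y]\<close>
  (\<open>nijenhuis_Lstar\<close>, \<open>nijenhuis_Rstar\<close>). The condition is linear in the action, so it passes to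
  \<open>-L\<^sup>* - R\<^sup>*\<close>.

  The two remaining compatibility conditions of a dual \<open>\<O>N\<close>-structure are those of a Leibniz
  \<open>r-n\<close> structure, since \<open>[\<alpha>, \<beta>]\<^sup>T\<close> is the bracket induced by \<open>T\<close> and the dual regular
  representation (\<open>rep_bracket_dual_regular\<close>).

  Finite dimension enters through the dual basis: it provides the vector \<open>\<pi>\<^sup>\<sharp> \<alpha>\<close> representing the
  functional \<open>\<pi> \<alpha>\<close> on the dual space (\<open>sharp_pairing\<close>), it lets covectors separate points, and it
  makes the dual space finitely generated.
\<close>

section \<open>The dual space\<close>

lemma vector_space_times: "vector_space ((*) :: 'k::field \<Rightarrow> 'k \<Rightarrow> 'k)"
  by unfold_locales (auto simp: algebra_simps)

lemma dual_iff:
  assumes "vector_space scale"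
  shows "\<alpha> \<in> dual scale \<longleftrightarrow>
    (\<forall>x y. \<alpha> (x + y) = \<alpha> x + \<alpha> y) \<and> (\<forall>c x. \<alpha> (scale c x) = c * \<alpha> x)"
  using assms vector_space_times by (auto simp: dual_def Vector_Spaces.linear_iff)

lemma dual_add: "\<alpha> \<in> dual scale \<Longrightarrow> \<alpha> (x + y) = \<alpha> x + \<alpha> y"
  and dual_scaled: "\<alpha> \<in> dual scale \<Longrightarrow> \<alpha> (scale c x) = c * \<alpha> x"
  by (auto simp: dual_def Vector_Spaces.linear_iff)

lemma dual_zero: "\<alpha> \<in> dual scale \<Longrightarrow> \<alpha> 0 = 0"
  using dual_add[of \<alpha> scale 0 0] by simp

lemma dual_diff: "\<alpha> \<in> dual scale \<Longrightarrow> \<alpha> (x - y) = \<alpha> x - \<alpha> y"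
  using dual_add[of \<alpha> scale "x - y" y] by (simp add: algebra_simps)

lemma dual_sum: "\<alpha> \<in> dual scale \<Longrightarrow> \<alpha> (\<Sum>i\<in>I. f i) = (\<Sum>i\<in>I. \<alpha> (f i))"
  by (induction I rule: infinite_finite_induct) (auto simp: dual_zero dual_add)

lemma vector_space_dual_scale:
  "vector_space (dual_scale :: 'k::field_char_0 \<Rightarrow> ('g \<Rightarrow> 'k) \<Rightarrow> 'g \<Rightarrow> 'k)"
  by unfold_locales (auto simp: dual_scale_def algebra_simps fun_eq_iff)

lemma subspace_dual:
  assumes "vector_space scale"
  shows "module.subspace dual_scale (dual scale)"
proof -
  interpret D: vector_space "dual_scale :: 'a \<Rightarrow> ('b \<Rightarrow> 'a) \<Rightarrow> 'b \<Rightarrow> 'a"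
    by (rule vector_space_dual_scale)
  show ?thesis
    unfolding D.subspace_def
    by (auto simp: dual_iff[OF assms] dual_scale_def algebra_simps)
qed

lemma sum_fun_apply: "(\<Sum>i\<in>I. f i) x = (\<Sum>i\<in>I. f i x)"
  by (induction I rule: infinite_finite_induct) auto

text \<open>
  The functionals \<open>e b\<close> are the coordinates with respect to the basis \<open>B\<close>. The expansion of a
  covector is obtained by applying it to the expansion of a vector.
\<close>

lemma dual_basis:
  fixes scale :: "'k::field_char_0 \<Rightarrow> 'g::ab_group_add \<Rightarrow> 'g"
  assumes B: "finite_dimensional_vector_space scale B"
  obtains e :: "'g \<Rightarrow> 'g \<Rightarrow> 'k"
  where "\<And>b. e b \<in> dual scale"
    and "\<And>x. (\<Sum>b\<in>B. scale (e b x) b) = x"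
    and "\<And>\<alpha>. \<alpha> \<in> dual scale \<Longrightarrow> (\<Sum>b\<in>B. dual_scale (\<alpha> b) (e b)) = \<alpha>"
proof -
  interpret finite_dimensional_vector_space scale B by (rule B)
  let ?e = "\<lambda>b x. representation B x b"
  have expand: "(\<Sum>b\<in>B. scale (?e b x) b) = x" for x
    by (rule sum_representation_eq) (auto simp: independent_Basis span_Basis finite_Basis)
  show thesis
  proof
    show "?e b \<in> dual scale" for b
      unfolding dual_def by (simp add: linear_representation independent_Basis span_Basis)
    show "(\<Sum>b\<in>B. scale (?e b x) b) = x" for x
      by (rule expand)
    show "(\<Sum>b\<in>B. dual_scale (\<alpha> b) (?e b)) = \<alpha>" if \<alpha>: "\<alpha> \<in> dual scale" for \<alpha>
    proof
      fix x
      have "(\<Sum>b\<in>B. dual_scale (\<alpha> b) (?e b)) x = \<alpha> (\<Sum>b\<in>B. scale (?e b x) b)"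
        by (simp add: sum_fun_apply dual_scale_def dual_sum[OF \<alpha>] dual_scaled[OF \<alpha>] mult.commute)
      then show "(\<Sum>b\<in>B. dual_scale (\<alpha> b) (?e b)) x = \<alpha> x"
        by (simp only: expand)
    qed
  qed
qed

lemma dual_finitely_generated:
  fixes scale :: "'k::field_char_0 \<Rightarrow> 'g::ab_group_add \<Rightarrow> 'g"
  assumes B: "finite_dimensional_vector_space scale B"
  shows "\<exists>E. finite E \<and> module.span dual_scale E = dual scale"
proof -
  interpret finite_dimensional_vector_space scale B by (rule B)
  interpret D: vector_space "dual_scale :: 'k \<Rightarrow> ('g \<Rightarrow> 'k) \<Rightarrow> 'g \<Rightarrow> 'k"
    by (rule vector_space_dual_scale)
  obtain e :: "'g \<Rightarrow> 'g \<Rightarrow> 'k" where e: "\<And>b. e b \<in> dual scale"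
    and expand: "\<And>\<alpha>. \<alpha> \<in> dual scale \<Longrightarrow> (\<Sum>b\<in>B. dual_scale (\<alpha> b) (e b)) = \<alpha>"
    by (rule dual_basis[OF B]) (rule that, assumption+)
  have "\<alpha> \<in> D.span (e ` B)" if "\<alpha> \<in> dual scale" for \<alpha>
  proof -
    have "(\<Sum>b\<in>B. dual_scale (\<alpha> b) (e b)) \<in> D.span (e ` B)"
      by (intro D.span_sum D.span_scale D.span_base) auto
    then show ?thesis by (simp only: expand[OF that])
  qed
  moreover have "D.span (e ` B) \<subseteq> dual scale"
  proof (rule D.span_minimal)
    show "e ` B \<subseteq> dual scale" using e by blast
    show "D.subspace (dual scale)" by (rule subspace_dual[OF vector_space_axioms])
  qed
  ultimately have "D.span (e ` B) = dual scale" by blast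
  then show ?thesis using finite_Basis by (intro exI[of _ "e ` B"]) simp
qed

lemma dual_separates_points:
  fixes scale :: "'k::field_char_0 \<Rightarrow> 'g::ab_group_add \<Rightarrow> 'g"
  assumes B: "finite_dimensional_vector_space scale B"
    and eq: "\<And>\<beta>. \<beta> \<in> dual scale \<Longrightarrow> \<beta> x = \<beta> y"
  shows "x = y"
proof -
  obtain e :: "'g \<Rightarrow> 'g \<Rightarrow> 'k" where e: "\<And>b. e b \<in> dual scale"
    and expand: "\<And>x. (\<Sum>b\<in>B. scale (e b x) b) = x"
    by (rule dual_basis[OF B]) (rule that, assumption+)
  have "(\<Sum>b\<in>B. scale (e b x) b) = (\<Sum>b\<in>B. scale (e b y) b)"
    using eq[OF e] by simp
  then show ?thesis by (simp only: expand)
qed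

text \<open>
  The canonical map into the bidual is onto: a functional \<open>\<phi>\<close> on the dual space is evaluation at the
  vector whose coordinates are the values of \<open>\<phi>\<close> on the dual basis.
\<close>

lemma bidual_representable:
  fixes scale :: "'k::field_char_0 \<Rightarrow> 'g::ab_group_add \<Rightarrow> 'g"
  assumes B: "finite_dimensional_vector_space scale B"
    and \<phi>: "linear_on dual_scale (*) (dual scale) UNIV \<phi>"
  obtains x where "\<And>\<beta>. \<beta> \<in> dual scale \<Longrightarrow> \<beta> x = \<phi> \<beta>"
proof -
  interpret finite_dimensional_vector_space scale B by (rule B)
  interpret D: vector_space "dual_scale :: 'k \<Rightarrow> ('g \<Rightarrow> 'k) \<Rightarrow> 'g \<Rightarrow> 'k"
    by (rule vector_space_dual_scale)
  have sub: "D.subspace (dual scale)" by (rule subspace_dual[OF vector_space_axioms])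
  obtain e :: "'g \<Rightarrow> 'g \<Rightarrow> 'k" where e: "\<And>b. e b \<in> dual scale"
    and expand: "\<And>\<alpha>. \<alpha> \<in> dual scale \<Longrightarrow> (\<Sum>b\<in>B. dual_scale (\<alpha> b) (e b)) = \<alpha>"
    by (rule dual_basis[OF B]) (rule that, assumption+)
  have add: "\<phi> (\<alpha> + \<beta>) = \<phi> \<alpha> + \<phi> \<beta>" if "\<alpha> \<in> dual scale" "\<beta> \<in> dual scale" for \<alpha> \<beta>
    using \<phi> that by (auto simp: linear_on_def)
  have sc: "\<phi> (dual_scale c \<alpha>) = c * \<phi> \<alpha>" if "\<alpha> \<in> dual scale" for c \<alpha>
    using \<phi> that by (auto simp: linear_on_def)
  have zero: "\<phi> 0 = 0"
    using add[of 0 0] D.subspace_0[OF sub] by simp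
  have sum: "\<phi> (\<Sum>i\<in>I. f i) = (\<Sum>i\<in>I. \<phi> (f i))" if "\<And>i. f i \<in> dual scale" for I :: "'g set" and f
    using that
    by (induction I rule: infinite_finite_induct) (auto simp: zero add D.subspace_sum[OF sub])
  have "\<beta> (\<Sum>b\<in>B. scale (\<phi> (e b)) b) = \<phi> \<beta>" if \<beta>: "\<beta> \<in> dual scale" for \<beta>
  proof -
    have "\<phi> \<beta> = \<phi> (\<Sum>b\<in>B. dual_scale (\<beta> b) (e b))" by (simp only: expand[OF \<beta>])
    also have "\<dots> = (\<Sum>b\<in>B. \<beta> b * \<phi> (e b))"
      by (simp add: sum sc e D.subspace_scale[OF sub])
    finally show ?thesis
      by (simp add: dual_sum[OF \<beta>] dual_scaled[OF \<beta>] mult.commute)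
  qed
  then show thesis using that by blast
qed

section \<open>The map induced by a symmetric tensor\<close>

text \<open>
  The description defining \<^const>\<open>sharp\<close> is proper: the functional \<open>\<pi> \<alpha>\<close> is represented by a vector,
  and only by one since covectors separate points.
\<close>

lemma sharp_pairing:
  fixes scale :: "'k::field_char_0 \<Rightarrow> 'g::ab_group_add \<Rightarrow> 'g"
  assumes B: "finite_dimensional_vector_space scale B"
    and \<pi>: "\<pi> \<in> Sym2 scale" and \<alpha>: "\<alpha> \<in> dual scale" and \<beta>: "\<beta> \<in> dual scale"
  shows "\<beta> (sharp scale \<pi> \<alpha>) = \<pi> \<alpha> \<beta>"
proof -
  have "linear_on dual_scale (*) (dual scale) UNIV (\<pi> \<alpha>)"
    using \<pi> \<alpha> by (auto simp: Sym2_def bilinear_on_def)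
  from bidual_representable[OF B this]
  obtain x where x: "\<And>\<beta>. \<beta> \<in> dual scale \<Longrightarrow> \<beta> x = \<pi> \<alpha> \<beta>" by blast
  have "\<forall>\<beta>\<in>dual scale. \<beta> (sharp scale \<pi> \<alpha>) = \<pi> \<alpha> \<beta>"
    unfolding sharp_def
  proof (rule theI)
    show "\<forall>\<beta>\<in>dual scale. \<beta> x = \<pi> \<alpha> \<beta>" using x by blast
    show "y = x" if "\<forall>\<beta>\<in>dual scale. \<beta> y = \<pi> \<alpha> \<beta>" for y
      by (rule dual_separates_points[OF B]) (simp add: x that)
  qed
  then show ?thesis using \<beta> by blast
qed

lemma linear_on_sharp:
  fixes scale :: "'k::field_char_0 \<Rightarrow> 'g::ab_group_add \<Rightarrow> 'g"
  assumes B: "finite_dimensional_vector_space scale B" and \<pi>: "\<pi> \<in> Sym2 scale"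
  shows "linear_on dual_scale scale (dual scale) UNIV (sharp scale \<pi>)"
proof -
  interpret finite_dimensional_vector_space scale B by (rule B)
  interpret D: vector_space "dual_scale :: 'k \<Rightarrow> ('g \<Rightarrow> 'k) \<Rightarrow> 'g \<Rightarrow> 'k"
    by (rule vector_space_dual_scale)
  have sub: "D.subspace (dual scale)" by (rule subspace_dual[OF vector_space_axioms])
  have lin: "linear_on dual_scale (*) (dual scale) UNIV (\<lambda>\<alpha>. \<pi> \<alpha> \<beta>)" if "\<beta> \<in> dual scale" for \<beta>
    using \<pi> that by (auto simp: Sym2_def bilinear_on_def)
  note pair = sharp_pairing[OF B \<pi>]
  show ?thesis
    unfolding linear_on_def
  proof (intro conjI ballI allI)
    fix \<alpha> \<beta> :: "'g \<Rightarrow> 'k" assume \<alpha>: "\<alpha> \<in> dual scale" and \<beta>: "\<beta> \<in> dual scale"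
    show "sharp scale \<pi> (\<alpha> + \<beta>) = sharp scale \<pi> \<alpha> + sharp scale \<pi> \<beta>"
      by (rule dual_separates_points[OF B])
        (use lin in \<open>simp add: pair \<alpha> \<beta> D.subspace_add[OF sub] dual_add linear_on_def\<close>)
  next
    fix c and \<alpha> :: "'g \<Rightarrow> 'k" assume \<alpha>: "\<alpha> \<in> dual scale"
    show "sharp scale \<pi> (dual_scale c \<alpha>) = scale c (sharp scale \<pi> \<alpha>)"
      by (rule dual_separates_points[OF B])
        (use lin in \<open>simp add: pair \<alpha> D.subspace_scale[OF sub] dual_scaled linear_on_def\<close>)
  qed simp
qed

section \<open>The dual regular representation\<close>

context leibniz_algebra
begin

lemma br_add_right: "br x (y + z) = br x y + br x z"
  and br_scale_right: "br x (scale c y) = scale c (br x y)"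
  using linear_right[of x] by (auto simp: Vector_Spaces.linear_iff)

lemma br_add_left: "br (x + y) z = br x z + br y z"
  and br_scale_left: "br (scale c x) z = scale c (br x z)"
  using linear_left[of z] by (auto simp: Vector_Spaces.linear_iff)

lemma br_zero: "br 0 x = 0" "br x 0 = 0"
  using br_add_left[of 0 0 x] br_add_right[of x 0 0] by simp_all

text \<open>
  A left Leibniz bracket need not be antisymmetric, but its symmetric part acts trivially from the
  left: the Leibniz identities for \<open>(x, y, z)\<close> and \<open>(y, x, z)\<close> add up to this. It is what makes the
  third axiom of a representation hold for the dual regular one.
\<close>

lemma left_mult_symmetric_zero: "br (br x y + br y x) z = 0"
proof -
  have "br (br x y) z + br (br y x) z = 0"
    using leibniz[of x y z] leibniz[of y x z] by (simp add: algebra_simps)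
  then show ?thesis by (simp add: br_add_left)
qed

lemma Lstar_dual: "\<alpha> \<in> dual scale \<Longrightarrow> Lstar br x \<alpha> \<in> dual scale"
  by (auto simp: dual_iff[OF vector_space_axioms] Lstar_def br_add_right br_scale_right)

lemma dual_regular_right_dual: "\<alpha> \<in> dual scale \<Longrightarrow> - Lstar br x \<alpha> - Rstar br x \<alpha> \<in> dual scale"
  by (auto simp: dual_iff[OF vector_space_axioms] Lstar_def Rstar_def br_add_right br_add_left
      br_scale_right br_scale_left algebra_simps)

lemma dual_regular_rep:
  "leibniz_rep scale br dual_scale (dual scale)
     (Lstar br) (\<lambda>x \<alpha>. - Lstar br x \<alpha> - Rstar br x \<alpha>)"
proof -
  obtain B where B: "finite_dimensional_vector_space scale B"
    using finite_dim by blast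
  have leib: "\<alpha> (br x (br y z)) = \<alpha> (br (br x y) z) + \<alpha> (br y (br x z))"
    if "\<alpha> \<in> dual scale" for \<alpha> :: "'g \<Rightarrow> 'k" and x y z
    unfolding leibniz[of x y z] by (rule dual_add[OF that])
  have L: "bilinear_on scale dual_scale dual_scale UNIV (dual scale) (dual scale) (Lstar br)"
    unfolding bilinear_on_def linear_on_def
    by (auto simp: Lstar_dual)
      (auto simp: Lstar_def fun_eq_iff dual_scale_def br_add_left br_scale_left dual_add dual_scaled)
  have R: "bilinear_on scale dual_scale dual_scale UNIV (dual scale) (dual scale)
      (\<lambda>x \<alpha>. - Lstar br x \<alpha> - Rstar br x \<alpha>)"
    unfolding bilinear_on_def linear_on_def
    by (auto simp: dual_regular_right_dual)
      (auto simp: Lstar_def Rstar_def fun_eq_iff dual_scale_def br_add_left br_scale_left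
        br_add_right br_scale_right dual_add dual_scaled algebra_simps)
  \<comment> \<open>Paired with a vector, the two commutator axioms become Leibniz identities under a covector.\<close>
  have LL: "Lstar br (br x y) \<alpha> = Lstar br x (Lstar br y \<alpha>) - Lstar br y (Lstar br x \<alpha>)"
    if \<alpha>: "\<alpha> \<in> dual scale" for \<alpha> x y
    by (rule ext) (simp add: Lstar_def leib[OF \<alpha>, of x y])
  have LR: "- Lstar br (br x y) \<alpha> - Rstar br (br x y) \<alpha>
      = Lstar br x (- Lstar br y \<alpha> - Rstar br y \<alpha>)
        - (- Lstar br y (Lstar br x \<alpha>) - Rstar br y (Lstar br x \<alpha>))"
    if \<alpha>: "\<alpha> \<in> dual scale" for \<alpha> x y
  proof
    fix z
    show "(- Lstar br (br x y) \<alpha> - Rstar br (br x y) \<alpha>) z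
      = (Lstar br x (- Lstar br y \<alpha> - Rstar br y \<alpha>)
        - (- Lstar br y (Lstar br x \<alpha>) - Rstar br y (Lstar br x \<alpha>))) z"
      using leib[OF \<alpha>, of x y z] leib[OF \<alpha>, of x z y]
      by (simp add: Lstar_def Rstar_def)
  qed
  have RR: "- Lstar br y (Lstar br x \<alpha>) - Rstar br y (Lstar br x \<alpha>)
      = - (- Lstar br y (- Lstar br x \<alpha> - Rstar br x \<alpha>) - Rstar br y (- Lstar br x \<alpha> - Rstar br x \<alpha>))"
    if \<alpha>: "\<alpha> \<in> dual scale" for \<alpha> x y
  proof
    fix z
    \<comment> \<open>\<open>L\<^sup>*(x) + \<rho>\<^sup>R(x)\<close> is the transpose of right multiplication by \<open>x\<close>, and \<open>\<rho>\<^sup>R(y)\<close> feeds it the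
        symmetric part of the bracket.\<close>
    have "\<alpha> (br (br y z) x) + \<alpha> (br (br z y) x) = 0"
      using left_mult_symmetric_zero[of y z x]
      by (simp add: br_add_left dual_add[OF \<alpha>, symmetric] dual_zero[OF \<alpha>])
    then show "(- Lstar br y (Lstar br x \<alpha>) - Rstar br y (Lstar br x \<alpha>)) z
      = (- (- Lstar br y (- Lstar br x \<alpha> - Rstar br x \<alpha>)
          - Rstar br y (- Lstar br x \<alpha> - Rstar br x \<alpha>))) z"
      by (simp add: Lstar_def Rstar_def algebra_simps)
  qed
  show ?thesis
    unfolding leibniz_rep_def
    using vector_space_dual_scale subspace_dual[OF vector_space_axioms]
      dual_finitely_generated[OF B] L R LL LR RR
    by blast
qed

section \<open>The Yang-Baxter equation and O-operators\<close>

lemma rep_bracket_dual_regular: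
  "rep_bracket (Lstar br) (\<lambda>x \<alpha>. - Lstar br x \<alpha> - Rstar br x \<alpha>) T = dual_bracket br T"
  by (intro ext) (simp add: rep_bracket_def dual_bracket_def)

text \<open>
  The product \<open>[T \<alpha>, T \<beta>]\<close> and each of the two summands of \<open>T [\<alpha>, \<beta>]\<^sup>T\<close> arise twice in the nested
  bracket, according to the order in which the two copies of \<open>T\<close> are inserted; hence the factor 2.
\<close>

lemma double_bracket_eq:
  assumes T: "linear_on dual_scale scale (dual scale) UNIV T"
    and \<alpha>: "\<alpha> \<in> dual scale" and \<beta>: "\<beta> \<in> dual scale"
  shows "double_bracket br T \<alpha> \<beta>
    = scale 2 (T (dual_bracket br T \<alpha> \<beta>) - br (T \<alpha>) (T \<beta>))"
proof -
  interpret D: vector_space "dual_scale :: 'k \<Rightarrow> ('g \<Rightarrow> 'k) \<Rightarrow> 'g \<Rightarrow> 'k"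
    by (rule vector_space_dual_scale)
  have sub: "D.subspace (dual scale)" by (rule subspace_dual[OF vector_space_axioms])
  have T_add: "T (\<alpha> + \<beta>) = T \<alpha> + T \<beta>" if "\<alpha> \<in> dual scale" "\<beta> \<in> dual scale" for \<alpha> \<beta>
    using T that by (auto simp: linear_on_def)
  have T0: "T 0 = 0"
    using T_add[of 0 0] D.subspace_0[OF sub] by simp
  let ?l = "Lstar br (T \<alpha>) \<beta>" and ?r = "- Lstar br (T \<beta>) \<alpha> - Rstar br (T \<beta>) \<alpha>"
  have star0: "Lstar br x 0 = 0" "Rstar br x 0 = 0" "Lstar br 0 \<alpha> = 0" "Rstar br 0 \<alpha> = 0"
    "Lstar br 0 \<beta> = 0" "Rstar br 0 \<beta> = 0" for x
    using \<alpha> \<beta> by (auto simp: Lstar_def Rstar_def fun_eq_iff br_zero dual_zero)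
  \<comment> \<open>Additivity of \<open>T\<close> is known on the dual space only, so \<open>T [\<alpha>, \<beta>]\<^sup>T\<close> has to be split into
      values of \<open>T\<close> at covectors that are known to be linear.\<close>
  have "dual_bracket br T \<alpha> \<beta> = ?l + ?r"
    by (simp add: dual_bracket_def)
  then have "T (dual_bracket br T \<alpha> \<beta>) = T ?l + T ?r"
    by (simp only: T_add[OF Lstar_dual[OF \<beta>] dual_regular_right_dual[OF \<alpha>]])
  moreover have "double_bracket br T \<alpha> \<beta> = T (dual_bracket br T \<alpha> \<beta>) + (T ?l + T ?r)
      - br (T \<alpha>) (T \<beta>) - br (T \<alpha>) (T \<beta>)"
    by (simp add: double_bracket_def balavoine_def mu_ltimes_def hat_def dual_bracket_def star0
        br_zero T0 algebra_simps zero_prod_def)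
  moreover have "scale 2 x = x + x" for x
    using scale_left_distrib[of 1 1 x] by simp
  ultimately show ?thesis by (simp add: algebra_simps)
qed

text \<open>
  Covectors separate points, so the trilinear form \<open>[[\<pi>, \<pi>]]\<close> vanishes only if the double bracket does.
\<close>

lemma r_matrix_O_operator:
  assumes "classical_leibniz_r_matrix scale br \<pi>"
  shows "O_operator scale br dual_scale (dual scale)
     (Lstar br) (\<lambda>x \<alpha>. - Lstar br x \<alpha> - Rstar br x \<alpha>) (sharp scale \<pi>)"
proof -
  obtain B where B: "finite_dimensional_vector_space scale B"
    using finite_dim by blast
  have \<pi>: "\<pi> \<in> Sym2 scale"
    using assms by (simp add: classical_leibniz_r_matrix_def)
  have YB: "\<xi> (double_bracket br (sharp scale \<pi>) \<alpha> \<beta>) = 0"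
    if "\<alpha> \<in> dual scale" "\<beta> \<in> dual scale" "\<xi> \<in> dual scale" for \<alpha> \<beta> \<xi>
    using assms that by (auto simp: classical_leibniz_r_matrix_def square_bracket_def)
  note lin = linear_on_sharp[OF B \<pi>]
  have "br (sharp scale \<pi> \<alpha>) (sharp scale \<pi> \<beta>) = sharp scale \<pi> (dual_bracket br (sharp scale \<pi>) \<alpha> \<beta>)"
    if \<alpha>: "\<alpha> \<in> dual scale" and \<beta>: "\<beta> \<in> dual scale" for \<alpha> \<beta>
  proof -
    have "double_bracket br (sharp scale \<pi>) \<alpha> \<beta> = 0"
      by (rule dual_separates_points[OF B]) (simp add: YB \<alpha> \<beta> dual_zero)
    then show ?thesis
      by (simp add: double_bracket_eq[OF lin \<alpha> \<beta>])
  qed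
  then show ?thesis
    using lin by (simp add: O_operator_def rep_bracket_dual_regular)
qed

section \<open>Nijenhuis operators on the dual regular representation\<close>

lemma nijenhuis_pairing:
  assumes N: "nijenhuis scale br N" and w: "w \<in> dual scale"
  shows "w (br (N x) (N y)) = w (N (br (N x) y)) + w (N (br x (N y))) - w (N (N (br x y)))"
proof -
  have add: "N (x + y) = N x + N y" for x y
    using N by (auto simp: nijenhuis_def Vector_Spaces.linear_iff)
  have diff: "N (x - y) = N x - N y" for x y
    using add[of "x - y" y] by (simp add: algebra_simps)
  have "br (N x) (N y) = N (br (N x) y) + N (br x (N y)) - N (N (br x y))"
    using N by (simp add: nijenhuis_def add diff)
  then show ?thesis by (simp add: dual_add[OF w] dual_diff[OF w])
qed

lemma nijenhuis_Lstar:
  assumes "nijenhuis scale br N" and "w \<in> dual scale"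
  shows "Lstar br (N y) (transpose_map N w)
    = transpose_map N (Lstar br (N y) w) + Lstar br y (transpose_map N (transpose_map N w))
      - transpose_map N (Lstar br y (transpose_map N w))"
  using nijenhuis_pairing[OF assms, of y]
  by (auto simp: Lstar_def transpose_map_def fun_eq_iff)

lemma nijenhuis_Rstar:
  assumes "nijenhuis scale br N" and "w \<in> dual scale"
  shows "Rstar br (N y) (transpose_map N w)
    = transpose_map N (Rstar br (N y) w) + Rstar br y (transpose_map N (transpose_map N w))
      - transpose_map N (Rstar br y (transpose_map N w))"
  using nijenhuis_pairing[OF assms, of _ y]
  by (auto simp: Rstar_def transpose_map_def fun_eq_iff)

end

lemma linear_on_transpose_map:
  assumes "Vector_Spaces.linear scale scale N"
  shows "linear_on dual_scale dual_scale (dual scale) (dual scale) (transpose_map N)"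
proof -
  have "vector_space scale" "\<And>x y. N (x + y) = N x + N y" "\<And>c x. N (scale c x) = scale c (N x)"
    using assms by (auto simp: Vector_Spaces.linear_iff)
  then show ?thesis
    by (auto simp: linear_on_def dual_iff transpose_map_def dual_scale_def fun_eq_iff)
qed

theorem theorem6p2:
  fixes scale :: "'k::field_char_0 \<Rightarrow> 'g::ab_group_add \<Rightarrow> 'g"
    and br :: "'g \<Rightarrow> 'g \<Rightarrow> 'g"
    and \<pi> :: "('g \<Rightarrow> 'k) \<Rightarrow> ('g \<Rightarrow> 'k) \<Rightarrow> 'k"
    and N :: "'g \<Rightarrow> 'g"
  assumes "leibniz_algebra scale br"
    and "leibniz_rn_structure scale br \<pi> N"
  shows "dual_ON_structure scale br dual_scale (dual scale)
           (Lstar br) (\<lambda>x \<alpha>. - Lstar br x \<alpha> - Rstar br x \<alpha>)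
           (sharp scale \<pi>) (transpose_map N) N"
proof -
  interpret leibniz_algebra scale br by (rule assms(1))
  let ?R = "\<lambda>x \<alpha>. - Lstar br x \<alpha> - Rstar br x \<alpha>"
  have r: "classical_leibniz_r_matrix scale br \<pi>" and N: "nijenhuis scale br N"
    and comm: "\<And>\<alpha>. \<alpha> \<in> dual scale \<Longrightarrow> N (sharp scale \<pi> \<alpha>) = sharp scale \<pi> (transpose_map N \<alpha>)"
    and compat: "\<And>\<alpha> \<beta>. \<alpha> \<in> dual scale \<Longrightarrow> \<beta> \<in> dual scale \<Longrightarrow>
      dual_bracket br (N \<circ> sharp scale \<pi>) \<alpha> \<beta>
        = deformed_bracket (dual_bracket br (sharp scale \<pi>)) (transpose_map N) \<alpha> \<beta>"
    using assms(2) by (auto simp: leibniz_rn_structure_def)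
  have S: "linear_on dual_scale dual_scale (dual scale) (dual scale) (transpose_map N)"
    using N linear_on_transpose_map by (auto simp: nijenhuis_def)
  have R: "?R (N y) (transpose_map N w)
      = transpose_map N (?R (N y) w) + ?R y (transpose_map N (transpose_map N w))
        - transpose_map N (?R y (transpose_map N w))" if w: "w \<in> dual scale" for y w
    unfolding nijenhuis_Lstar[OF N w] nijenhuis_Rstar[OF N w]
    by (simp add: transpose_map_def fun_eq_iff)
  have "Lstar br (N (sharp scale \<pi> w)) u + ?R (N (sharp scale \<pi> u)) w
      = deformed_bracket (rep_bracket (Lstar br) ?R (sharp scale \<pi>)) (transpose_map N) w u"
    if "w \<in> dual scale" "u \<in> dual scale" for w u
    using compat[OF that] unfolding rep_bracket_dual_regular[symmetric]
    by (simp add: rep_bracket_def)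
  then show ?thesis
    unfolding dual_ON_structure_def
    using dual_regular_rep r_matrix_O_operator[OF r] S N nijenhuis_Lstar[OF N] R comm
    by auto
qed

end
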